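(* Let $\mathbb{H}_1,\mathbb{H}_2$ be finite-dimensional real Hilbert spaces and let $\mathcal{T}_A,\mathcal{T}_B\in\mathcal{B}(\mathbb{H}_1\times\mathbb{H}_2,\mathbb{R})$ be non-zero. Then $\mathcal{T}_A\perp_B\mathcal{T}_B$ if and only if there exists $(x_0,y_0)\in M_{\mathcal{T}_A}$ such that $\mathcal{T}_B(x_0,y_0)=0$.
   Context: All spaces are real. $S_{\mathbb{H}}$ denotes the unit sphere of $\mathbb{H}$. $\mathcal{B}(\mathbb{H}_1\times\mathbb{H}_2,\mathbb{R})$ is the Banach space of all real bilinear forms on $\mathbb{H}_1\times\mathbb{H}_2$, with the norm $\|\mathcal{T}\|=\sup_{(x,y)\in S_{\mathbb{H}_1}\times S_{\mathbb{H}_2}}|\mathcal{T}(x,y)|$. With $\dim\mathbb{H}_1=m$ and $\dim\mathbb{H}_2=n$, each real $m\times n$ matrix $A$ is identified with a linear operator from $\mathbb{H}_2$ to $\mathbb{H}_1$ and induces the bilinear form $\mathcal{T}_A(x,y)=\langle x,Ay\rangle$ for $(x,y)\in\mathbb{H}_1\times\mathbb{H}_2$, where $\langle\cdot,\cdot\rangle$ is the inner product of $\mathbb{H}_1$ ($\langle x_1,x_2\rangle=x_1^Tx_2$). Every bilinear form in $\mathcal{B}(\mathbb{H}_1\times\mathbb{H}_2,\mathbb{R})$ equals $\mathcal{T}_A$ for a unique $m\times n$ matrix $A$, so $\mathcal{T}_A,\mathcal{T}_B$ denote arbitrary members of this space. The norm attainment set of $\mathcal{T}_A$ is $M_{\mathcal{T}_A}=\{(x,y)\in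 S_{\mathbb{H}_1}\times S_{\mathbb{H}_2}:|\mathcal{T}_A(x,y)|=\|\mathcal{T}_A\|\}$. Birkhoff-James orthogonality: $\mathcal{T}_A\perp_B\mathcal{T}_B$ means $\|\mathcal{T}_A+\lambda\mathcal{T}_B\|\geq\|\mathcal{T}_A\|$ for all $\lambda\in\mathbb{R}$. *)

theory Defs
  imports "HOL-Analysis.Analysis"
begin

(* Finite-dimensional real Hilbert spaces are types of class euclidean_space, and the members of
   B(H1 x H2, R) are the curried functions T satisfying "bilinear T".  The class forces the
   dimension to be positive; a zero-dimensional space carries no non-zero bilinear form. *)

definition bform_norm :: "('a::euclidean_space \<Rightarrow> 'b::euclidean_space \<Rightarrow> real) \<Rightarrow> real" where
  "bform_norm T = (SUP (x, y) \<in> sphere 0 1 \<times> sphere 0 1. \<bar>T x y\<bar>)"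

definition norm_attainment_set ::
  "('a::euclidean_space \<Rightarrow> 'b::euclidean_space \<Rightarrow> real) \<Rightarrow> ('a \<times> 'b) set" where
  "norm_attainment_set T = {(x, y). x \<in> sphere 0 1 \<and> y \<in> sphere 0 1 \<and> \<bar>T x y\<bar> = bform_norm T}"

definition birkhoff_james_orthogonal ::
  "('a::euclidean_space \<Rightarrow> 'b::euclidean_space \<Rightarrow> real) \<Rightarrow> ('a \<Rightarrow> 'b \<Rightarrow> real) \<Rightarrow> bool"
  (infix "\<bottom>\<^sub>B" 50) where
  "T \<bottom>\<^sub>B S \<longleftrightarrow> (\<forall>c::real. bform_norm (\<lambda>x y. T x y + c * S x y) \<ge> bform_norm T)"

(* The supremum in bform_norm is over a non-empty set that is bounded for bilinear forms. *)
lemma bform_norm_bdd_above: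
  fixes T :: "'a::euclidean_space \<Rightarrow> 'b::euclidean_space \<Rightarrow> real"
  assumes "bilinear T"
  shows "bdd_above ((\<lambda>(x, y). \<bar>T x y\<bar>) ` (sphere 0 1 \<times> sphere 0 1))"
proof -
  obtain K where K: "\<And>x y. norm (T x y) \<le> K * norm x * norm y"
    using bilinear_bounded[OF assms] by blast
  show ?thesis
  proof (rule bdd_aboveI2)
    fix p :: "'a \<times> 'b" assume "p \<in> sphere 0 1 \<times> sphere 0 1"
    then show "(case p of (x, y) \<Rightarrow> \<bar>T x y\<bar>) \<le> K"
      using K[of "fst p" "snd p"] by (auto simp: case_prod_beta)
  qed
qed

(* The forms T_A(x, y) = <x, A y> induced by linear operators A from H2 to H1 are exactly the
   bilinear forms, and A is determined by its form. *)
lemma bilinear_inner_linear: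
  fixes A :: "'b::euclidean_space \<Rightarrow> 'a::euclidean_space"
  assumes "linear A"
  shows "bilinear (\<lambda>x y. x \<bullet> A y)"
  using assms unfolding bilinear_def
  by (auto intro!: linearI simp: inner_simps linear_add linear_scale)

lemma bilinear_eq_inner_operator:
  fixes T :: "'a::euclidean_space \<Rightarrow> 'b::euclidean_space \<Rightarrow> real"
  assumes "bilinear T"
  shows "\<exists>!A. linear A \<and> T = (\<lambda>x y. x \<bullet> A y)"
proof (rule ex1I)
  let ?A = "\<lambda>y. \<Sum>i\<in>Basis. T i y *\<^sub>R i"
  have lin1: "linear (\<lambda>x. T x y)" and lin2: "linear (T x)" for x y
    using assms by (auto simp: bilinear_def)
  have "linear ?A"
    by (intro linearI)
      (simp_all add: linear_add[OF lin2] linear_scale[OF lin2] scaleR_add_left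
        sum.distrib scaleR_sum_right)
  moreover have "T x y = x \<bullet> ?A y" for x y
  proof -
    have "T x y = T (\<Sum>i\<in>Basis. (x \<bullet> i) *\<^sub>R i) y"
      by (simp add: euclidean_representation)
    also have "\<dots> = (\<Sum>i\<in>Basis. (x \<bullet> i) * T i y)"
      by (simp add: linear_sum[OF lin1] linear_scale[OF lin1])
    also have "\<dots> = x \<bullet> ?A y"
      by (simp add: inner_sum_right mult.commute)
    finally show ?thesis .
  qed
  ultimately show "linear ?A \<and> T = (\<lambda>x y. x \<bullet> ?A y)" by blast
  fix A assume A: "linear A \<and> T = (\<lambda>x y. x \<bullet> A y)"
  with \<open>\<And>x y. T x y = x \<bullet> ?A y\<close> have "x \<bullet> A y = x \<bullet> ?A y" for x y
    by metis
  then show "A = ?A"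
    by (intro ext) (metis vector_eq_rdot inner_commute)
qed

end

theory Submission
  imports Defs
begin

text \<open>
  Write \<open>N\<close> for the norm of the form \<open>T\<close>. If \<open>S\<close> vanishes at a point where \<open>T\<close> attains its norm,
  then the absolute value there of every \<open>T + c S\<close> is still \<open>N\<close>, which gives orthogonality.

  For the converse, let \<open>P\<close> be the set of pairs of unit vectors with \<open>T x y = N\<close>. If \<open>T\<close> is
  orthogonal to \<open>S\<close>, norming points of \<open>T + c S\<close> accumulate, as \<open>c\<close> decreases to \<open>0\<close>, at a point
  of \<open>P\<close> where \<open>S \<ge> 0\<close>
  (\<open>orthogonal_imp_norming_nonneg\<close>); replacing \<open>S\<close> by \<open>-S\<close> yields a point of \<open>P\<close> where \<open>S \<le> 0\<close>.
  By the equality case of the Cauchy-Schwarz inequality, \<open>(x, y)\<close> in \<open>P\<close> means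
  \<open>T x' y = N (x' \<bullet> x)\<close> and \<open>T x y' = N (y' \<bullet> y)\<close> for all \<open>x'\<close>, \<open>y'\<close> (\<open>norming_pair_represents\<close>),
  that is, \<open>x\<close> and \<open>y\<close> are left and right singular vectors for the largest singular value \<open>N\<close>.
  These conditions are linear in \<open>(x, y)\<close> and, as \<open>N > 0\<close>, force both components to have the same
  length, so the segment joining the two points consists of scalar multiples of points of \<open>P\<close>
  (\<open>norming_pair_combination\<close>), and the intermediate value theorem gives a zero of \<open>S\<close> on it. The
  segment meets the origin only if the two points are antipodal; then \<open>S\<close> takes the same value at
  both, and this value is \<open>0\<close>.
\<close>

lemma bilinear_tendsto:
  fixes T :: "'a::euclidean_space \<Rightarrow> 'b::euclidean_space \<Rightarrow> 'c::real_normed_vector"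
  assumes "bilinear T" and "(f \<longlongrightarrow> a) F" and "(g \<longlongrightarrow> b) F"
  shows "((\<lambda>i. T (f i) (g i)) \<longlongrightarrow> T a b) F"
  using assms bounded_bilinear.tendsto bilinear_conv_bounded_bilinear by blast

lemma bilinear_add_scaled:
  fixes T S :: "'a::real_vector \<Rightarrow> 'b::real_vector \<Rightarrow> real"
  assumes "bilinear T" and "bilinear S"
  shows "bilinear (\<lambda>x y. T x y + c * S x y)"
  using assms unfolding bilinear_def linear_iff by (auto simp: algebra_simps)

lemma abs_le_bform_norm:
  fixes T :: "'a::euclidean_space \<Rightarrow> 'b::euclidean_space \<Rightarrow> real"
  assumes "bilinear T" and "norm x = 1" and "norm y = 1"
  shows "\<bar>T x y\<bar> \<le> bform_norm T"
proof -
  have "(case (x, y) of (x, y) \<Rightarrow> \<bar>T x y\<bar>) \<le> bform_norm T"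
    unfolding bform_norm_def
    by (rule cSUP_upper[OF _ bform_norm_bdd_above[OF assms(1)]]) (use assms in auto)
  then show ?thesis by simp
qed

lemma abs_le_bform_norm_mult:
  fixes T :: "'a::euclidean_space \<Rightarrow> 'b::euclidean_space \<Rightarrow> real"
  assumes "bilinear T"
  shows "\<bar>T x y\<bar> \<le> bform_norm T * norm x * norm y"
proof (cases "x = 0 \<or> y = 0")
  case True
  then show ?thesis using assms by (auto simp: bilinear_lzero bilinear_rzero)
next
  case False
  then have "\<bar>T (x /\<^sub>R norm x) (y /\<^sub>R norm y)\<bar> \<le> bform_norm T"
    by (intro abs_le_bform_norm assms) auto
  then show ?thesis using False
    by (simp add: bilinear_lmul[OF assms] bilinear_rmul[OF assms] abs_mult field_simps)
qed

lemma bform_norm_pos: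
  fixes T :: "'a::euclidean_space \<Rightarrow> 'b::euclidean_space \<Rightarrow> real"
  assumes "bilinear T" and "T \<noteq> (\<lambda>x y. 0)"
  shows "bform_norm T > 0"
proof (rule ccontr)
  assume "\<not> bform_norm T > 0"
  then have "bform_norm T * (norm x * norm y) \<le> 0" for x :: 'a and y :: 'b
    by (intro mult_nonpos_nonneg) auto
  then have "\<bar>T x y\<bar> \<le> 0" for x y
    using abs_le_bform_norm_mult[OF assms(1), of x y] by (metis mult.assoc order_trans)
  then have "T = (\<lambda>x y. 0)" by auto
  with assms(2) show False ..
qed

text \<open>The supremum is attained by compactness, and replacing \<open>x\<close> by \<open>-x\<close> removes the absolute value.\<close>

lemma bform_norm_attained:
  fixes T :: "'a::euclidean_space \<Rightarrow> 'b::euclidean_space \<Rightarrow> real"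
  assumes "bilinear T"
  obtains x y where "norm x = 1" and "norm y = 1" and "T x y = bform_norm T"
proof -
  let ?K = "sphere (0::'a) 1 \<times> sphere (0::'b) 1"
  let ?f = "\<lambda>p. \<bar>T (fst p) (snd p)\<bar>"
  have K: "compact ?K" "?K \<noteq> {}"
    by (auto intro: compact_Times)
  have "continuous_on ?K ?f"
    unfolding continuous_on_def
    by (intro ballI tendsto_rabs bilinear_tendsto[OF assms] tendsto_fst tendsto_snd tendsto_ident_at)
  then obtain p where p: "p \<in> ?K" "\<And>q. q \<in> ?K \<Longrightarrow> ?f q \<le> ?f p"
    using continuous_attains_sup[OF K] by blast
  have "bform_norm T \<le> ?f p"
    unfolding bform_norm_def
    by (rule cSUP_least) (use K p(2) in \<open>auto simp: case_prod_beta\<close>)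
  moreover have "?f p \<le> bform_norm T"
    by (rule abs_le_bform_norm[OF assms]) (use p(1) in auto)
  ultimately have eq: "\<bar>T (fst p) (snd p)\<bar> = bform_norm T" by simp
  show ?thesis
  proof (cases "T (fst p) (snd p) \<ge> 0")
    case True
    then show ?thesis using that[of "fst p" "snd p"] eq p(1) by auto
  next
    case False
    then show ?thesis using that[of "- fst p" "snd p"] eq p(1)
      by (auto simp: bilinear_lneg[OF assms])
  qed
qed

text \<open>
  By orthogonality, if \<open>T + c S\<close> with \<open>c > 0\<close> attains its norm as a value at unit vectors
  \<open>(x, y)\<close>, then \<open>T x y + c * S x y \<ge> bform_norm T \<ge> T x y\<close>. Hence \<open>S x y \<ge> 0\<close>, and the inequalities pass to
  a limit point as \<open>c\<close> tends to \<open>0\<close>.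
\<close>

lemma orthogonal_imp_norming_nonneg:
  fixes T S :: "'a::euclidean_space \<Rightarrow> 'b::euclidean_space \<Rightarrow> real"
  assumes T: "bilinear T" and S: "bilinear S" and orth: "T \<bottom>\<^sub>B S"
  obtains x y where "norm x = 1" and "norm y = 1" and "T x y = bform_norm T" and "S x y \<ge> 0"
proof -
  let ?K = "sphere (0::'a) 1 \<times> sphere (0::'b) 1"
  let ?c = "\<lambda>n. inverse (real (Suc n))"
  have "\<exists>p \<in> ?K. T (fst p) (snd p) + ?c n * S (fst p) (snd p) \<ge> bform_norm T" for n
  proof -
    obtain x y where xy: "norm x = 1" "norm y = 1"
      "T x y + ?c n * S x y = bform_norm (\<lambda>x y. T x y + ?c n * S x y)"
      using bform_norm_attained[OF bilinear_add_scaled[OF T S, of "?c n"]] by blast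
    have "bform_norm T \<le> T x y + ?c n * S x y"
      using orth xy(3) unfolding birkhoff_james_orthogonal_def by metis
    then show ?thesis using xy by (intro bexI[of _ "(x, y)"]) auto
  qed
  then obtain p where pK: "\<And>n. p n \<in> ?K"
    and p: "\<And>n. T (fst (p n)) (snd (p n)) + ?c n * S (fst (p n)) (snd (p n)) \<ge> bform_norm T"
    by metis
  have "compact ?K" by (intro compact_Times compact_sphere)
  then obtain q r where q: "q \<in> ?K" and r: "strict_mono r" and lim: "(p \<circ> r) \<longlonglongrightarrow> q"
    using pK unfolding compact_def by meson
  have limx: "(\<lambda>n. fst (p (r n))) \<longlonglongrightarrow> fst q" and limy: "(\<lambda>n. snd (p (r n))) \<longlonglongrightarrow> snd q"
    using tendsto_fst[OF lim] tendsto_snd[OF lim] by (simp_all add: o_def)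
  have limS: "(\<lambda>n. S (fst (p (r n))) (snd (p (r n)))) \<longlonglongrightarrow> S (fst q) (snd q)"
    and limT: "(\<lambda>n. T (fst (p (r n))) (snd (p (r n)))) \<longlonglongrightarrow> T (fst q) (snd q)"
    by (rule bilinear_tendsto[OF S limx limy], rule bilinear_tendsto[OF T limx limy])
  have limc: "(\<lambda>n. ?c (r n)) \<longlonglongrightarrow> 0"
    using LIMSEQ_subseq_LIMSEQ[OF LIMSEQ_inverse_real_of_nat r] by (simp add: o_def)
  have T_le: "T (fst (p n)) (snd (p n)) \<le> bform_norm T" for n
    using abs_le_bform_norm[OF T, of "fst (p n)" "snd (p n)"] pK[of n] by (auto simp: mem_Times_iff)
  have S_nonneg: "S (fst (p n)) (snd (p n)) \<ge> 0" for n
  proof -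
    have "?c n * S (fst (p n)) (snd (p n)) \<ge> 0"
      using p[of n] T_le[of n] by linarith
    then show ?thesis by (simp add: zero_le_mult_iff)
  qed
  have "S (fst q) (snd q) \<ge> 0"
    by (rule LIMSEQ_le_const[OF limS]) (use S_nonneg in auto)
  moreover have "T (fst q) (snd q) + 0 * S (fst q) (snd q) \<ge> bform_norm T"
    by (rule LIMSEQ_le_const[OF tendsto_add[OF limT tendsto_mult[OF limc limS]]])
      (use p in auto)
  moreover have "T (fst q) (snd q) \<le> bform_norm T"
    using abs_le_bform_norm[OF T, of "fst q" "snd q"] q by (auto simp: mem_Times_iff)
  ultimately show ?thesis
    using that[of "fst q" "snd q"] q by (auto simp: mem_Times_iff)
qed

text \<open>The equality case of the Cauchy-Schwarz inequality, for a functional of norm \<open>N\<close>.\<close>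

lemma linear_functional_eq_inner_norming:
  fixes f :: "'a::euclidean_space \<Rightarrow> real"
  assumes "linear f" and bound: "\<And>z. \<bar>f z\<bar> \<le> N * norm z" and "norm x = 1" and "f x = N"
  shows "f z = N * (z \<bullet> x)"
proof -
  define a where "a = adjoint f 1"
  have fa: "f z = z \<bullet> a" for z
    using adjoint_works[OF assms(1), of z 1] by (simp add: a_def)
  have "N \<ge> 0"
    using bound[of x] assms(3) by simp
  have "norm a * norm a \<le> N * norm a"
    using bound[of a] by (simp add: fa flip: power2_norm_eq_inner power2_eq_square)
  then have "norm a \<le> N"
    using \<open>N \<ge> 0\<close> by (cases "a = 0") auto
  then have "(norm a)\<^sup>2 \<le> N\<^sup>2"
    by (simp add: power_mono)
  moreover have "(norm (a - N *\<^sub>R x))\<^sup>2 = (norm a)\<^sup>2 - N\<^sup>2"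
  proof -
    have "x \<bullet> x = 1" using assms(3) by (simp flip: power2_norm_eq_inner)
    moreover have "x \<bullet> a = N" using assms(4) fa by simp
    ultimately show ?thesis
      unfolding power2_norm_eq_inner
      by (simp add: inner_diff_left inner_diff_right inner_commute[of a x] power2_eq_square)
  qed
  ultimately have "(norm (a - N *\<^sub>R x))\<^sup>2 \<le> 0" by linarith
  then have "a = N *\<^sub>R x" by simp
  then show ?thesis by (simp add: fa)
qed

lemma norming_pair_represents:
  fixes T :: "'a::euclidean_space \<Rightarrow> 'b::euclidean_space \<Rightarrow> real"
  assumes T: "bilinear T" and "norm x = 1" and "norm y = 1" and "T x y = bform_norm T"
  shows "T x' y = bform_norm T * (x' \<bullet> x)" and "T x y' = bform_norm T * (y' \<bullet> y)"
proof -
  have lin: "linear (\<lambda>z. T z y)" "linear (T x)"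
    using T by (auto simp: bilinear_def)
  show "T x' y = bform_norm T * (x' \<bullet> x)"
    by (rule linear_functional_eq_inner_norming[OF lin(1)])
      (use assms abs_le_bform_norm_mult[OF T, of _ y] in auto)
  show "T x y' = bform_norm T * (y' \<bullet> y)"
    by (rule linear_functional_eq_inner_norming[OF lin(2)])
      (use assms abs_le_bform_norm_mult[OF T, of x] in auto)
qed

text \<open>
  The two components of a combination of norming pairs have the same length, and a non-zero
  combination becomes a norming pair once both are divided by this length.
\<close>

lemma norming_pair_combination:
  fixes T :: "'a::euclidean_space \<Rightarrow> 'b::euclidean_space \<Rightarrow> real"
  assumes T: "bilinear T" and pos: "bform_norm T > 0"
    and 1: "norm x1 = 1" "norm y1 = 1" "T x1 y1 = bform_norm T"
    and 2: "norm x2 = 1" "norm y2 = 1" "T x2 y2 = bform_norm T"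
  defines "u \<equiv> \<lambda>a b. a *\<^sub>R x1 + b *\<^sub>R x2" and "v \<equiv> \<lambda>a b. a *\<^sub>R y1 + b *\<^sub>R y2"
  shows "norm (u a b) = norm (v a b)"
    and "T (u a b) (v a b) = bform_norm T * (norm (u a b))\<^sup>2"
proof -
  have unit: "x1 \<bullet> x1 = 1" "x2 \<bullet> x2 = 1" "y1 \<bullet> y1 = 1" "y2 \<bullet> y2 = 1"
    using 1 2 by (simp_all flip: power2_norm_eq_inner)
  \<comment> \<open>Evaluate \<open>T x1 y2\<close> through both norming pairs.\<close>
  have T12: "T x1 y2 = bform_norm T * (x1 \<bullet> x2)" "T x1 y2 = bform_norm T * (y1 \<bullet> y2)"
    using norming_pair_represents(1)[OF T 2, of x1] norming_pair_represents(2)[OF T 1, of y2]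
    by (simp_all only: inner_commute)
  then have same: "x1 \<bullet> x2 = y1 \<bullet> y2"
    using pos by simp
  have T21: "T x2 y1 = bform_norm T * (x1 \<bullet> x2)"
    using norming_pair_represents(1)[OF T 1, of x2] by (simp only: inner_commute)
  have nu: "(norm (u a b))\<^sup>2 = a\<^sup>2 + b\<^sup>2 + 2 * a * b * (x1 \<bullet> x2)"
    unfolding power2_norm_eq_inner
    by (simp add: u_def inner_add_left inner_add_right unit
        inner_commute[of x2 x1] power2_eq_square algebra_simps)
  have "(norm (v a b))\<^sup>2 = a\<^sup>2 + b\<^sup>2 + 2 * a * b * (x1 \<bullet> x2)"
    unfolding power2_norm_eq_inner
    by (simp add: v_def inner_add_left inner_add_right unit same
        inner_commute[of y2 y1] power2_eq_square algebra_simps)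
  with nu show "norm (u a b) = norm (v a b)"
    by (metis norm_ge_zero power2_eq_imp_eq)
  show "T (u a b) (v a b) = bform_norm T * (norm (u a b))\<^sup>2"
    unfolding nu
    by (simp add: u_def v_def bilinear_ladd[OF T] bilinear_radd[OF T] bilinear_lmul[OF T]
        bilinear_rmul[OF T] 1(3) 2(3) T12(1) T21 power2_eq_square algebra_simps)
qed

lemma norming_pair_zero:
  fixes T S :: "'a::euclidean_space \<Rightarrow> 'b::euclidean_space \<Rightarrow> real"
  assumes T: "bilinear T" and S: "bilinear S" and pos: "bform_norm T > 0"
    and 1: "norm x1 = 1" "norm y1 = 1" "T x1 y1 = bform_norm T" and S1: "S x1 y1 \<ge> 0"
    and 2: "norm x2 = 1" "norm y2 = 1" "T x2 y2 = bform_norm T" and S2: "S x2 y2 \<le> 0"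
  obtains x y where "norm x = 1" and "norm y = 1" and "T x y = bform_norm T" and "S x y = 0"
proof -
  define u where "u = (\<lambda>t. (1 - t) *\<^sub>R x1 + t *\<^sub>R x2)"
  define v where "v = (\<lambda>t. (1 - t) *\<^sub>R y1 + t *\<^sub>R y2)"
  have len: "norm (u t) = norm (v t)"
    and Tuv: "T (u t) (v t) = bform_norm T * (norm (u t))\<^sup>2" for t
    using norming_pair_combination[OF T pos 1 2] by (simp_all add: u_def v_def)
  have "continuous_on {0..1} (\<lambda>t. S (u t) (v t))"
    unfolding continuous_on_def u_def v_def
    by (intro ballI bilinear_tendsto[OF S] tendsto_intros)
  then obtain t where t: "0 \<le> t" "t \<le> 1" and zero: "S (u t) (v t) = 0"
    using IVT2'[of "\<lambda>t. S (u t) (v t)" 1 0 0] S1 S2 by (auto simp: u_def v_def)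
  show ?thesis
  proof (cases "u t = 0")
    case True
    then have "v t = 0" using len[of t] by simp
    have x: "(1 - t) *\<^sub>R x1 = - (t *\<^sub>R x2)" and y: "(1 - t) *\<^sub>R y1 = - (t *\<^sub>R y2)"
      using True \<open>v t = 0\<close> by (simp_all add: u_def v_def add_eq_0_iff2)
    have "1 - t = t"
      using arg_cong[OF x, of norm] 1(1) 2(1) t by simp
    have "t \<noteq> 0" using \<open>1 - t = t\<close> by auto
    moreover have "t *\<^sub>R x1 = t *\<^sub>R (- x2)" "t *\<^sub>R y1 = t *\<^sub>R (- y2)"
      using x y unfolding \<open>1 - t = t\<close> by simp_all
    ultimately have "x1 = - x2" "y1 = - y2"
      by (metis scaleR_cancel_left)+
    then have "S x1 y1 = S x2 y2"
      by (simp add: bilinear_lneg[OF S] bilinear_rneg[OF S])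
    then show ?thesis using that[OF 1] S1 S2 by simp
  next
    case False
    let ?x = "u t /\<^sub>R norm (u t)" and ?y = "v t /\<^sub>R norm (u t)"
    have "norm ?x = 1" "norm ?y = 1"
      using False by (simp_all flip: len)
    moreover have "T ?x ?y = bform_norm T" "S ?x ?y = 0"
      using False zero Tuv[of t]
      by (simp_all add: bilinear_lmul[OF T] bilinear_rmul[OF T] bilinear_lmul[OF S]
          bilinear_rmul[OF S] power2_eq_square field_simps)
    ultimately show ?thesis using that by blast
  qed
qed

theorem theorem2p5:
  fixes T\<^sub>A T\<^sub>B :: "'a::euclidean_space \<Rightarrow> 'b::euclidean_space \<Rightarrow> real"
  assumes "bilinear T\<^sub>A" and "bilinear T\<^sub>B"
    and "T\<^sub>A \<noteq> (\<lambda>x y. 0)" and "T\<^sub>B \<noteq> (\<lambda>x y. 0)"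
  shows "T\<^sub>A \<bottom>\<^sub>B T\<^sub>B \<longleftrightarrow> (\<exists>(x\<^sub>0, y\<^sub>0) \<in> norm_attainment_set T\<^sub>A. T\<^sub>B x\<^sub>0 y\<^sub>0 = 0)"
proof
  assume orth: "T\<^sub>A \<bottom>\<^sub>B T\<^sub>B"
  have pos: "bform_norm T\<^sub>A > 0"
    using assms(1,3) by (rule bform_norm_pos)
  obtain x1 y1 where 1: "norm x1 = 1" "norm y1 = 1" "T\<^sub>A x1 y1 = bform_norm T\<^sub>A" "T\<^sub>B x1 y1 \<ge> 0"
    using orthogonal_imp_norming_nonneg[OF assms(1,2) orth] .
  have neg: "bilinear (\<lambda>x y. - T\<^sub>B x y)"
    using bilinear_add_scaled[OF assms(2,2), of "-2"] by simp
  have "T\<^sub>A \<bottom>\<^sub>B (\<lambda>x y. - T\<^sub>B x y)"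
    unfolding birkhoff_james_orthogonal_def
  proof
    fix c :: real
    show "bform_norm (\<lambda>x y. T\<^sub>A x y + c * - T\<^sub>B x y) \<ge> bform_norm T\<^sub>A"
      using orth[unfolded birkhoff_james_orthogonal_def, rule_format, of "- c"] by simp
  qed
  then obtain x2 y2 where 2: "norm x2 = 1" "norm y2 = 1" "T\<^sub>A x2 y2 = bform_norm T\<^sub>A" "- T\<^sub>B x2 y2 \<ge> 0"
    using orthogonal_imp_norming_nonneg[OF assms(1) neg] by blast
  then have "T\<^sub>B x2 y2 \<le> 0" by simp
  then obtain x y where "norm x = 1" "norm y = 1" "T\<^sub>A x y = bform_norm T\<^sub>A" "T\<^sub>B x y = 0"
    using norming_pair_zero[OF assms(1,2) pos 1 2(1-3)] by blast
  then show "\<exists>(x\<^sub>0, y\<^sub>0) \<in> norm_attainment_set T\<^sub>A. T\<^sub>B x\<^sub>0 y\<^sub>0 = 0"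
    using pos by (intro bexI[of _ "(x, y)"]) (auto simp: norm_attainment_set_def)
next
  assume "\<exists>(x\<^sub>0, y\<^sub>0) \<in> norm_attainment_set T\<^sub>A. T\<^sub>B x\<^sub>0 y\<^sub>0 = 0"
  then obtain x y where xy: "norm x = 1" "norm y = 1" "\<bar>T\<^sub>A x y\<bar> = bform_norm T\<^sub>A" "T\<^sub>B x y = 0"
    by (auto simp: norm_attainment_set_def)
  show "T\<^sub>A \<bottom>\<^sub>B T\<^sub>B"
    unfolding birkhoff_james_orthogonal_def
  proof
    fix c :: real
    show "bform_norm (\<lambda>x y. T\<^sub>A x y + c * T\<^sub>B x y) \<ge> bform_norm T\<^sub>A"
      using abs_le_bform_norm[OF bilinear_add_scaled[OF assms(1,2), of c] xy(1,2)] xy(3,4) by simp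
  qed
qed

end
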